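(* Let $A, B \in \mathbb{R}^{n\times n}$ with $A$ nonsingular. (1) If $\rho(A^{-1}B\bar{D}) < 1$ for every diagonal matrix $\bar{D} = \mathrm{diag}(\bar{d}_{i}) \in \mathbb{R}^{n\times n}$ with $\bar{d}_{i}\in[-1,1]$ for all $i$, then for every $b \in \mathbb{R}^n$ the generalized absolute value equation $Ax + B|x| = b$ has a unique solution $x \in \mathbb{R}^n$. (2) If $\rho(A^{-1}\bar{D}) < 1$ for every diagonal matrix $\bar{D} = \mathrm{diag}(\bar{d}_{i}) \in \mathbb{R}^{n\times n}$ with $\bar{d}_{i}\in[-1,1]$ for all $i$, then for every $b \in \mathbb{R}^n$ the absolute value equation $Ax + |x| = b$ has a unique solution $x \in \mathbb{R}^n$.
   Context: For $x \in \mathbb{R}^n$, $|x|$ denotes the componentwise absolute value of $x$. $\rho(\cdot)$ denotes the spectral radius of a matrix (the maximum modulus of its complex eigenvalues). *)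

theory Defs
  imports "HOL-Analysis.Analysis"
begin

definition diag_matrix :: "'a::zero ^ 'n \<Rightarrow> 'a ^ 'n ^ 'n" where
  "diag_matrix d = (\<chi> i j. if i = j then d $ i else 0)"

definition eigenvalues :: "complex ^ 'n ^ 'n \<Rightarrow> complex set" where
  "eigenvalues M = {k. \<exists>v. v \<noteq> 0 \<and> M *v v = k *s v}"

text \<open>The eigenvalues are those of the complexified matrix. As every index type is nonempty and
  finite, a square matrix has at least one and only finitely many of them, so the maximum exists.\<close>

definition spectral_radius :: "real ^ 'n ^ 'n \<Rightarrow> real" where
  "spectral_radius M = Max (cmod ` eigenvalues (map_matrix complex_of_real M))"

text \<open>On \<^typ>\<open>real ^ 'n\<close> the library's \<open>\<bar>x\<bar>\<close> is the componentwise absolute value, see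
  \<open>abs_vec_def\<close>.\<close>

end

theory Submission
  imports Defs
begin

text \<open>If \<open>\<rho>(A\<inverse>BD) < 1\<close> for every diagonal \<open>D\<close> with entries in \<open>[-1,1]\<close>, then \<open>-1\<close> is never an
  eigenvalue of \<open>A\<inverse>BD\<close>, so every \<open>A + BD\<close> is nonsingular. By compactness of the set of these \<open>D\<close>
  there is \<open>c > 0\<close> with \<open>\<parallel>(A + BD)v\<parallel> \<ge> c\<parallel>v\<parallel>\<close> for all \<open>D\<close> and \<open>v\<close>. Since \<open>\<bar>x\<bar> - \<bar>y\<bar> = D(x - y)\<close> for
  some such \<open>D\<close>, the map \<open>F x = Ax + B\<bar>x\<bar>\<close> satisfies \<open>\<parallel>F x - F y\<parallel> \<ge> c\<parallel>x - y\<parallel>\<close>. Hence \<open>F\<close> is injective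
  with closed image, and the image is open by invariance of domain, so \<open>F\<close> is bijective.\<close>

lemma eigenvalues_iff_det: "k \<in> eigenvalues M \<longleftrightarrow> det (mat k - M) = 0"
proof -
  have "M *v v = k *s v \<longleftrightarrow> (mat k - M) *v v = 0" for v
    by (auto simp: vec_eq_iff matrix_vector_mult_def mat_def sum_subtractf left_diff_distrib
        if_distrib[of "\<lambda>x. x * _"] cong: if_cong)
  then show ?thesis
    unfolding eigenvalues_def
    using invertible_det_nz[of "mat k - M"] matrix_left_invertible_ker[of "mat k - M"]
      invertible_left_inverse[of "mat k - M"]
    by auto
qed

text \<open>Evaluation at \<open>k\<close> is a ring homomorphism, so it commutes with the Leibniz
  formula. This allows a characteristic polynomial to be formed as a determinant over the polynomial
  ring.\<close>

lemma poly_det: "poly (det P) k = det (\<chi> i j. poly (P $ i $ j) k)"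
  for P :: "'a::comm_ring_1 poly ^ 'n ^ 'n"
  by (simp add: det_def poly_sum poly_prod of_int_poly)

text \<open>In the row of an entry of largest modulus of an eigenvector, that entry can be
  cancelled. The crude bound serves to exhibit a number that is not an eigenvalue.\<close>

lemma norm_eigenvalue_le:
  assumes "k \<in> eigenvalues M"
  shows "cmod k \<le> (\<Sum>i\<in>UNIV. \<Sum>j\<in>UNIV. cmod (M $ i $ j))"
proof -
  obtain v where "v \<noteq> 0" and v: "M *v v = k *s v"
    using assms by (auto simp: eigenvalues_def)
  have "Max (range (\<lambda>j. cmod (v $ j))) \<in> range (\<lambda>j. cmod (v $ j))"
    by (intro Max_in) auto
  then obtain i where "Max (range (\<lambda>j. cmod (v $ j))) = cmod (v $ i)"
    by (rule imageE)
  then have i: "cmod (v $ j) \<le> cmod (v $ i)" for j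
    by (metis Max_ge finite finite_imageI rangeI)
  have pos: "cmod (v $ i) > 0"
  proof (rule ccontr)
    assume "\<not> ?thesis"
    then have "cmod (v $ j) \<le> 0" for j
      using i[of j] by linarith
    then show False
      using \<open>v \<noteq> 0\<close> by (simp add: vec_eq_iff)
  qed
  have "cmod k * cmod (v $ i) = cmod ((M *v v) $ i)"
    by (simp add: v norm_mult)
  also have "\<dots> \<le> (\<Sum>j\<in>UNIV. cmod (M $ i $ j) * cmod (v $ i))"
    unfolding matrix_vector_mult_def
    by (auto simp: norm_mult intro!: sum_norm_le mult_left_mono i)
  also have "\<dots> = (\<Sum>j\<in>UNIV. cmod (M $ i $ j)) * cmod (v $ i)"
    by (simp add: sum_distrib_right)
  finally have "cmod k \<le> (\<Sum>j\<in>UNIV. cmod (M $ i $ j))"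
    using pos by simp
  also have "\<dots> \<le> (\<Sum>i\<in>UNIV. \<Sum>j\<in>UNIV. cmod (M $ i $ j))"
    by (intro member_le_sum) (auto intro: sum_nonneg)
  finally show ?thesis .
qed

text \<open>The eigenvalues are the roots of the characteristic polynomial. Finiteness makes the
  \<open>Max\<close> in \<open>spectral_radius\<close> an upper bound.\<close>

lemma finite_eigenvalues: "finite (eigenvalues M)"
proof -
  define p where "p = det (\<chi> i j. (if i = j then [:0, 1:] else 0) - [:M $ i $ j:])"
  have "poly p k = det (mat k - M)" for k
    unfolding p_def poly_det mat_def by (rule arg_cong[of _ _ det]) (auto simp: vec_eq_iff)
  then have roots: "eigenvalues M = {k. poly p k = 0}"
    by (auto simp: eigenvalues_iff_det)
  define K where "K = (\<Sum>i\<in>UNIV. \<Sum>j\<in>UNIV. cmod (M $ i $ j))"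
  have "K \<ge> 0"
    by (auto simp: K_def intro!: sum_nonneg)
  \<comment> \<open>A number beyond the eigenvalue bound is not a root of \<open>p\<close>, which
    gives \<open>p \<noteq> 0\<close> without computing its degree or leading coefficient.\<close>
  then have "of_real (K + 1) \<notin> eigenvalues M"
    using norm_eigenvalue_le[of "of_real (K + 1)" M] unfolding K_def[symmetric] norm_of_real by auto
  then have "p \<noteq> 0"
    unfolding roots by auto
  then show ?thesis
    unfolding roots by (rule poly_roots_finite)
qed

lemma abs_real_eigenvalue_le_spectral_radius:
  fixes M :: "real ^ 'n ^ 'n"
  assumes "v \<noteq> 0" "M *v v = k *s v"
  shows "\<bar>k\<bar> \<le> spectral_radius M"
proof -
  let ?w = "\<chi> i. complex_of_real (v $ i)"
  have "(map_matrix complex_of_real M *v ?w) $ i = (of_real k *s ?w) $ i" for i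
  proof -
    have "(map_matrix complex_of_real M *v ?w) $ i = of_real ((M *v v) $ i)"
      by (simp add: matrix_vector_mult_def)
    then show ?thesis
      by (simp add: assms)
  qed
  moreover have "?w \<noteq> 0"
    using assms(1) by (simp add: vec_eq_iff)
  ultimately have "of_real k \<in> eigenvalues (map_matrix complex_of_real M)"
    unfolding eigenvalues_def vec_eq_iff[of "_ *v _"] by blast
  then have "cmod (of_real k) \<le> spectral_radius M"
    unfolding spectral_radius_def by (intro Max_ge finite_imageI finite_eigenvalues imageI)
  then show ?thesis
    by simp
qed

lemma diag_matrix_mult_vec: "diag_matrix d *v x = (\<chi> i. d $ i * x $ i)"
  by (simp add: diag_matrix_def matrix_vector_mult_def vec_eq_iff if_distrib[of "\<lambda>x. x * _"]
      cong: if_cong)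

lemma abs_diff_eq_diag_matrix:
  fixes x y :: "real ^ 'n"
  obtains d where "\<And>i. d $ i \<in> {-1..1}" "\<bar>x\<bar> - \<bar>y\<bar> = diag_matrix d *v (x - y)"
proof
  \<comment> \<open>Where \<open>x $ i = y $ i\<close>, division by zero yields 0, which lies in the
    interval and fits since both differences vanish.\<close>
  define d where "d = (\<chi> i. (\<bar>x $ i\<bar> - \<bar>y $ i\<bar>) / (x $ i - y $ i))"
  have "\<bar>d $ i\<bar> \<le> 1" for i
    using abs_triangle_ineq3[of "x $ i" "y $ i"] by (auto simp: d_def divide_le_eq)
  then show "d $ i \<in> {-1..1}" for i
    by (simp add: abs_le_iff minus_le_iff)
  show "\<bar>x\<bar> - \<bar>y\<bar> = diag_matrix d *v (x - y)"
    by (auto simp: diag_matrix_mult_vec d_def vec_eq_iff abs_vec_def)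
qed

lemma uniform_lower_bound_diag_matrix:
  fixes A B :: "real ^ 'n ^ 'n"
  assumes "\<And>d v. \<forall>i. d $ i \<in> {-1..1} \<Longrightarrow> v \<noteq> 0 \<Longrightarrow> A *v v + B *v (diag_matrix d *v v) \<noteq> 0"
  obtains c where "c > 0"
    "\<And>d v. \<forall>i. d $ i \<in> {-1..1} \<Longrightarrow> c * norm v \<le> norm (A *v v + B *v (diag_matrix d *v v))"
proof -
  define f where "f = (\<lambda>(d, v). norm (A *v v + B *v (diag_matrix d *v v)))"
  \<comment> \<open>Restricting \<open>v\<close> to the unit sphere makes the domain compact and
    keeps \<open>v\<close> nonzero, so the minimum of \<open>f\<close> is attained and
    positive.\<close>
  define S :: "((real ^ 'n) \<times> (real ^ 'n)) set"
    where "S = cbox (\<chi> i. -1) (\<chi> i. 1) \<times> sphere 0 1"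
  have S_iff: "(d, v) \<in> S \<longleftrightarrow> (\<forall>i. d $ i \<in> {-1..1}) \<and> norm v = 1" for d v
    by (auto simp: S_def mem_box_cart)
  have "S \<noteq> {}"
    using S_iff[of 0 "axis undefined 1"] by force
  moreover have "compact S"
    unfolding S_def by (intro compact_Times compact_cbox compact_sphere)
  moreover have "continuous_on S f"
    unfolding f_def case_prod_unfold diag_matrix_mult_vec
    unfolding matrix_vector_mult_def by (intro continuous_intros)
  ultimately obtain p where p: "p \<in> S" "\<And>q. q \<in> S \<Longrightarrow> f p \<le> f q"
    using continuous_attains_inf[of S f] by auto
  show thesis
  proof
    show "f p > 0"
      using p(1) assms[of "fst p" "snd p"] by (cases p) (force simp: S_iff f_def)
    fix d v :: "real ^ 'n"
    assume d: "\<forall>i. d $ i \<in> {-1..1}"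
    show "f p * norm v \<le> norm (A *v v + B *v (diag_matrix d *v v))"
    proof (cases "v = 0")
      case False
      \<comment> \<open>For fixed \<open>d\<close> the expression is linear in \<open>v\<close>, so
        the bound at the unit vector scales to \<open>v\<close>.\<close>
      let ?u = "(1 / norm v) *\<^sub>R v"
      have "f p \<le> f (d, ?u)"
        using False d by (intro p(2)) (simp add: S_iff)
      also have "A *v ?u + B *v (diag_matrix d *v ?u)
          = (1 / norm v) *\<^sub>R (A *v v + B *v (diag_matrix d *v v))"
        by (simp only: matrix_vector_mult_scaleR scaleR_add_right)
      then have "f (d, ?u) = norm (A *v v + B *v (diag_matrix d *v v)) / norm v"
        by (simp add: f_def)
      finally show ?thesis
        using False by (simp add: field_simps)
    qed simp
  qed
qed

lemma bij_if_continuous_expanding: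
  fixes f :: "'a::euclidean_space \<Rightarrow> 'a"
  assumes cont: "continuous_on UNIV f" and "c > 0"
    and lower: "\<And>x y. c * norm (x - y) \<le> norm (f x - f y)"
  shows "bij f"
proof -
  have "inj f"
  proof (rule injI)
    fix x y assume "f x = f y"
    then show "x = y"
      using lower[of x y] \<open>c > 0\<close> by (simp add: mult_le_0_iff)
  qed
  then have "open (range f)"
    using invariance_of_domain[OF cont] by simp
  moreover have "closed (range f)"
  proof (rule complete_imp_closed, rule completeI)
    fix s :: "nat \<Rightarrow> 'a"
    assume "\<forall>n. s n \<in> range f" "Cauchy s"
    then have "\<exists>x. \<forall>n. s n = f (x n)"
      by (intro choice) auto
    then obtain x where x: "s = (\<lambda>n. f (x n))"
      by blast
    \<comment> \<open>The lower bound transfers the Cauchy property from the images back to the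
      preimages.\<close>
    have "Cauchy x"
    proof (rule metric_CauchyI)
      fix e :: real assume "e > 0"
      then obtain N where N: "\<And>m n. m \<ge> N \<Longrightarrow> n \<ge> N \<Longrightarrow> norm (s m - s n) < c * e"
        using CauchyD[OF \<open>Cauchy s\<close>, of "c * e"] \<open>c > 0\<close> by auto
      have "dist (x m) (x n) < e" if "m \<ge> N" "n \<ge> N" for m n
      proof -
        have "c * norm (x m - x n) < c * e"
          using lower[of "x m" "x n"] N[OF that] by (simp add: x)
        then show ?thesis
          using \<open>c > 0\<close> by (simp add: dist_norm)
      qed
      then show "\<exists>N. \<forall>m\<ge>N. \<forall>n\<ge>N. dist (x m) (x n) < e"
        by blast
    qed
    then obtain l where "x \<longlonglongrightarrow> l"
      using Cauchy_convergent convergent_def by blast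
    then have "s \<longlonglongrightarrow> f l"
      unfolding x by (intro continuous_on_tendsto_compose[OF cont]) auto
    then show "\<exists>l\<in>range f. s \<longlonglongrightarrow> l"
      by blast
  qed
  ultimately have "range f = UNIV"
    using clopen[of "range f"] by simp
  with \<open>inj f\<close> show ?thesis
    by (simp add: bij_def)
qed

lemma matrix_inv_left: "invertible A \<Longrightarrow> matrix_inv A ** A = mat 1"
  unfolding invertible_def matrix_inv_def by (rule someI2_ex) auto

lemma ex1_generalized_absolute_value_equation:
  fixes A B :: "real ^ 'n ^ 'n"
  assumes "invertible A"
    and rho: "\<And>d. \<forall>i. d $ i \<in> {-1..1} \<Longrightarrow>
      spectral_radius (matrix_inv A ** B ** diag_matrix d) < 1"
  shows "\<exists>!x. A *v x + B *v \<bar>x\<bar> = b"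
proof -
  have "A *v v + B *v (diag_matrix d *v v) \<noteq> 0"
    if d: "\<forall>i. d $ i \<in> {-1..1}" and "v \<noteq> 0" for d v
  proof
    assume "A *v v + B *v (diag_matrix d *v v) = 0"
    then have "B *v (diag_matrix d *v v) = - (A *v v)"
      by (simp add: eq_neg_iff_add_eq_0 add.commute)
    then have "(matrix_inv A ** B ** diag_matrix d) *v v = matrix_inv A *v (- (A *v v))"
      by (simp add: matrix_vector_mul_assoc[symmetric])
    \<comment> \<open>The negation is pulled out by reading it as the difference
      \<open>0 - A *v v\<close>.\<close>
    also have "\<dots> = - ((matrix_inv A ** A) *v v)"
      using matrix_vector_mult_diff_distrib[of "matrix_inv A" 0 "A *v v"]
      by (simp add: matrix_vector_mul_assoc)
    also have "\<dots> = (-1) *s v"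
      using assms(1) by (simp add: matrix_inv_left vec_eq_iff)
    \<comment> \<open>Here \<open>-1\<close> is an eigenvalue, so the spectral radius is at least
      1.\<close>
    finally show False
      using abs_real_eigenvalue_le_spectral_radius[OF \<open>v \<noteq> 0\<close>] rho[OF d] by fastforce
  qed
  then obtain c where "c > 0" and c: "\<And>d v. \<forall>i. d $ i \<in> {-1..1} \<Longrightarrow>
      c * norm v \<le> norm (A *v v + B *v (diag_matrix d *v v))"
    using uniform_lower_bound_diag_matrix[of A B] by blast
  let ?F = "\<lambda>x. A *v x + B *v \<bar>x\<bar>"
  have "bij ?F"
  proof (rule bij_if_continuous_expanding)
    show "continuous_on UNIV ?F"
      unfolding matrix_vector_mult_def abs_vec_def by (intro continuous_intros)
    fix x y :: "real ^ 'n"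
    obtain d where d: "\<And>i. d $ i \<in> {-1..1}" "\<bar>x\<bar> - \<bar>y\<bar> = diag_matrix d *v (x - y)"
      using abs_diff_eq_diag_matrix[of x y] by blast
    have "?F x - ?F y = A *v (x - y) + B *v (\<bar>x\<bar> - \<bar>y\<bar>)"
      by (simp add: matrix_vector_mult_diff_distrib)
    then show "c * norm (x - y) \<le> norm (?F x - ?F y)"
      using c[of d "x - y"] d by simp
  qed fact
  then show ?thesis
    by (simp add: bij_iff)
qed

theorem theorem3p3:
  fixes A B :: "real ^ 'n ^ 'n"
  assumes "invertible A"
  shows "((\<forall>d :: real ^ 'n. (\<forall>i. d $ i \<in> {-1..1}) \<longrightarrow>
             spectral_radius (matrix_inv A ** B ** diag_matrix d) < 1) \<longrightarrow>
          (\<forall>b :: real ^ 'n. \<exists>!x :: real ^ 'n. A *v x + B *v \<bar>x\<bar> = b)) \<and>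
         ((\<forall>d :: real ^ 'n. (\<forall>i. d $ i \<in> {-1..1}) \<longrightarrow>
             spectral_radius (matrix_inv A ** diag_matrix d) < 1) \<longrightarrow>
          (\<forall>b :: real ^ 'n. \<exists>!x :: real ^ 'n. A *v x + \<bar>x\<bar> = b))"
  \<comment> \<open>The second claim is the case where \<open>B\<close> is the identity
    matrix.\<close>
  using ex1_generalized_absolute_value_equation[OF assms, of B]
    ex1_generalized_absolute_value_equation[OF assms, of "mat 1"]
  by simp

end
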